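(* Let $n$ and $k$ be even and let $\mathbb{M}_n$ be an $n$-dimensional manifold with local coordinates $z^i$ and symplectic form $\tilde\omega_{ij}(z)$; let $\omega^{ij}$ be the inverse matrix of $\tilde\omega_{ij}$ and $\{A,B\}=\partial_iA\,\omega^{ij}\,\partial_jB$ the corresponding Poisson bracket. Let $\Phi^\alpha(z)$, $\alpha=1,\dots,n-k$, be functionally independent functions, with coordinates grouped as $z^i=(z^\alpha,z^a)$, $\det(\partial\Phi^\alpha/\partial z^\beta)\neq0$, and let $z^\alpha=f^\alpha(z^a)$ be the parametric equations of the submanifold $\mathbb{N}_k=\{z\in\mathbb{M}_n:\Phi^\alpha(z)=0\}$. Let $\tilde\omega_{\mathbf f\,ab}$ be the restriction of $\tilde\omega$ to $\mathbb{N}_k$, i.e. with the embedding $x^a\mapsto z^i(x)=(f^\alpha(x),x^a)$, $$\tilde\omega_{\mathbf f\,ab}(x)=\frac{\partial z^i}{\partial x^a}\frac{\partial z^j}{\partial x^b}\,\tilde\omega_{ij}(f^\alpha(x),x).$$ Then $\tilde\omega_{\mathbf f}$ is nondegenerate ($\det\tilde\omega_{\mathbf f}\ne0$) and closed ($\partial_a\tilde\omega_{\mathbf f\,bc}+\partial_b\tilde\omega_{\mathbf f\,ca}+\partial_c\tilde\omega_{\mathbf f\,ab}=0$) if and only if $$\det\{\Phi^\alpha,\Phi^\beta\}\neq0\quad\text{on }\mathbb{N}_k.$$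
   Context: All objects are smooth, and all statements are local (valid in some neighbourhood of the point in question). Repeated indices are summed; $\partial_i=\partial/\partial z^i$. A symplectic form is a covariant tensor $\tilde\omega_{ij}(z)$ with $\tilde\omega_{ij}=-\tilde\omega_{ji}$, $\det\tilde\omega\ne0$ and $\partial_i\tilde\omega_{jk}+\partial_j\tilde\omega_{ki}+\partial_k\tilde\omega_{ij}=0$. Functions $\Phi^\alpha$, $\alpha=1,\dots,n-k$, are functionally independent if $\operatorname{rank}(\partial_i\Phi^\alpha)=n-k$; coordinates are then grouped as $z^i=(z^\alpha,z^a)$, $a=1,\dots,k$, with $\det(\partial\Phi^\alpha/\partial z^\beta)\ne0$, so that $\Phi^\alpha=0$ can be solved as $z^\alpha=f^\alpha(z^a)$ and $z^a$ are local coordinates on $\mathbb{N}_k$. *)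

theory Defs
  imports "HOL-Analysis.Analysis"
begin

text \<open>
  Everything is local, so the manifold is an open subset of a coordinate space \<open>real ^ 'n\<close>.
  When the coordinates are grouped as \<open>(z\<^sup>\<alpha>, z\<^sup>a)\<close>, the index type is a sum \<open>'m + 'k\<close> of finite types:
  \<open>Inl \<alpha>\<close> is the index of a dependent coordinate, \<open>Inr a\<close> that of a coordinate on the submanifold,
  \<open>CARD('k)\<close> is \<open>k\<close>, \<open>CARD('m)\<close> is \<open>n - k\<close> and \<open>CARD('m + 'k)\<close> is \<open>n\<close>.
\<close>

text \<open>\<open>C\<^sup>r\<close> and \<open>C\<^sup>\<infinity>\<close> on a set; meant for open sets in a finite-dimensional space.\<close>

fun Cr_on :: "nat \<Rightarrow> 'a::real_normed_vector set \<Rightarrow> ('a \<Rightarrow> 'b::real_normed_vector) \<Rightarrow> bool" where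
  "Cr_on 0 S F \<longleftrightarrow> continuous_on S F"
| "Cr_on (Suc r) S F \<longleftrightarrow>
     (\<forall>x\<in>S. F differentiable (at x)) \<and>
     (\<forall>v. Cr_on r S (\<lambda>x. frechet_derivative F (at x) v))"

definition smooth_on :: "'a::real_normed_vector set \<Rightarrow> ('a \<Rightarrow> 'b::real_normed_vector) \<Rightarrow> bool" where
  "smooth_on S F \<longleftrightarrow> (\<forall>r. Cr_on r S F)"

definition pderiv_at :: "'n \<Rightarrow> (real ^ 'n \<Rightarrow> real) \<Rightarrow> real ^ 'n::finite \<Rightarrow> real" where
  "pderiv_at i F z = frechet_derivative F (at z) (axis i 1)"

definition nondegenerate_on :: "(real ^ 'n::finite) set \<Rightarrow> (real ^ 'n \<Rightarrow> real ^ 'n ^ 'n) \<Rightarrow> bool" where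
  "nondegenerate_on S w \<longleftrightarrow> (\<forall>z\<in>S. det (w z) \<noteq> 0)"

definition closed_form_on :: "(real ^ 'n::finite) set \<Rightarrow> (real ^ 'n \<Rightarrow> real ^ 'n ^ 'n) \<Rightarrow> bool" where
  "closed_form_on S w \<longleftrightarrow> (\<forall>z\<in>S. \<forall>i j l.
     pderiv_at i (\<lambda>y. w y $ j $ l) z + pderiv_at j (\<lambda>y. w y $ l $ i) z
       + pderiv_at l (\<lambda>y. w y $ i $ j) z = 0)"

definition symplectic_form_on :: "(real ^ 'n::finite) set \<Rightarrow> (real ^ 'n \<Rightarrow> real ^ 'n ^ 'n) \<Rightarrow> bool" where
  "symplectic_form_on S w \<longleftrightarrow>
     smooth_on S w \<and> (\<forall>z\<in>S. \<forall>i j. w z $ i $ j = - (w z $ j $ i)) \<and>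
     nondegenerate_on S w \<and> closed_form_on S w"

definition poisson_bracket ::
  "(real ^ 'n \<Rightarrow> real ^ 'n ^ 'n) \<Rightarrow> (real ^ 'n \<Rightarrow> real) \<Rightarrow> (real ^ 'n \<Rightarrow> real) \<Rightarrow> real ^ 'n::finite \<Rightarrow> real" where
  "poisson_bracket w A B z =
     (\<Sum>i\<in>UNIV. \<Sum>j\<in>UNIV. pderiv_at i A z * matrix_inv (w z) $ i $ j * pderiv_at j B z)"

definition graph_embedding ::
  "(real ^ 'k \<Rightarrow> real ^ 'm) \<Rightarrow> real ^ 'k::finite \<Rightarrow> real ^ ('m::finite + 'k)" where
  "graph_embedding f x = (\<chi> i. case i of Inl \<alpha> \<Rightarrow> f x $ \<alpha> | Inr a \<Rightarrow> x $ a)"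

definition restricted_form ::
  "(real ^ ('m::finite + 'k::finite) \<Rightarrow> real ^ ('m + 'k) ^ ('m + 'k)) \<Rightarrow>
   (real ^ 'k \<Rightarrow> real ^ 'm) \<Rightarrow> real ^ 'k \<Rightarrow> real ^ 'k ^ 'k" where
  "restricted_form w f x = (\<chi> a b. \<Sum>i\<in>UNIV. \<Sum>j\<in>UNIV.
     pderiv_at a (\<lambda>y. graph_embedding f y $ i) x *
     pderiv_at b (\<lambda>y. graph_embedding f y $ j) x *
     w (graph_embedding f x) $ i $ j)"

end

theory Submission
  imports Defs
begin

text \<open>
  Closedness of the restricted form costs nothing: a pullback of a closed form is closed, by equality
  of mixed partial derivatives and skew symmetry. So everything is about nondegeneracy. Let \<open>T\<close> be the
  Jacobian of the embedding and \<open>F\<close> that of \<open>\<Phi>\<close>. Then \<open>F T = 0\<close>, and the coordinate splitting gives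
  \<open>ker F = im T\<close> and \<open>ker T\<^sup>t = im F\<^sup>t\<close>. A kernel vector \<open>x\<close> of \<open>T\<^sup>t \<omega> T\<close> therefore yields \<open>y\<close> with
  \<open>\<omega> T x = F\<^sup>t y\<close>, and this \<open>y\<close> lies in the kernel of the bracket matrix \<open>F \<omega>\<^sup>-\<^sup>1 F\<^sup>t\<close>; the
  correspondence can be reversed.
\<close>

section \<open>Symmetry of second derivatives\<close>

text \<open>Two uses of the one-variable mean value theorem, first along \<open>u\<close> and then
  along \<open>v\<close>. The point of the formula is that its left side is symmetric in
  \<open>u\<close> and \<open>v\<close>, while its right side differentiates in a definite
  order.\<close>

lemma second_difference_mvt:
  fixes g :: "'a::real_normed_vector \<Rightarrow> real"
  assumes "Cr_on 2 S g" and "h > 0"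
    and S: "\<And>s t. \<lbrakk>0 \<le> s; s \<le> h; 0 \<le> t; t \<le> h\<rbrakk> \<Longrightarrow> x + s *\<^sub>R u + t *\<^sub>R v \<in> S"
  obtains s t where "0 \<le> s" "s \<le> h" "0 \<le> t" "t \<le> h"
    "g (x + h *\<^sub>R u + h *\<^sub>R v) - g (x + h *\<^sub>R u) - g (x + h *\<^sub>R v) + g x
      = h\<^sup>2 * frechet_derivative (\<lambda>y. frechet_derivative g (at y) u) (at (x + s *\<^sub>R u + t *\<^sub>R v)) v"
proof -
  let ?g' = "\<lambda>y. frechet_derivative g (at y)"
  have g: "(g has_derivative ?g' y) (at y)" if "y \<in> S" for y
    using assms(1) that by (auto simp: numeral_2_eq_2 frechet_derivative_works[symmetric])
  have g': "((\<lambda>y. ?g' y u) has_derivative frechet_derivative (\<lambda>y. ?g' y u) (at y)) (at y)" if "y \<in> S" for y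
    using assms(1) that by (auto simp: numeral_2_eq_2 frechet_derivative_works[symmetric])
  \<comment> \<open>Restricting to the line through \<open>a\<close> in direction \<open>w\<close>
    turns a Frechet derivative into an ordinary real derivative, which is the form that
    \<open>MVT2\<close> takes.\<close>
  have line: "((\<lambda>s. G (a + s *\<^sub>R w)) has_real_derivative G' w) (at s)"
    if "(G has_derivative G') (at (a + s *\<^sub>R w))" for G :: "'a \<Rightarrow> real" and G' a w s
  proof -
    have "((\<lambda>s. G (a + s *\<^sub>R w)) has_derivative (\<lambda>s. G' (s *\<^sub>R w))) (at s)"
      by (rule has_derivative_compose[where f = "\<lambda>s. a + s *\<^sub>R w" and g = G and g' = G'])
        (use that in \<open>auto intro!: derivative_eq_intros\<close>)
    moreover have "G' (r *\<^sub>R w) = G' w * r" for r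
      using linear_scale[OF has_derivative_linear[OF that]] by simp
    ultimately show ?thesis by (simp add: has_field_derivative_def mult_commute_abs)
  qed
  \<comment> \<open>The increment of \<open>g\<close> across \<open>h *\<^sub>R v\<close>, viewed as
    a function of the displacement along \<open>u\<close>; the second difference is
    \<open>\<phi> h - \<phi> 0\<close>.\<close>
  define \<phi> where "\<phi> s = g ((x + h *\<^sub>R v) + s *\<^sub>R u) - g (x + s *\<^sub>R u)" for s
  have "(\<phi> has_real_derivative ?g' ((x + h *\<^sub>R v) + s *\<^sub>R u) u - ?g' (x + s *\<^sub>R u) u) (at s)"
    if "0 \<le> s" "s \<le> h" for s
    unfolding \<phi>_def
    by (intro DERIV_diff line[where G = g and G' = "?g' y" for y] g)
      (use S[of s h] S[of s 0] that \<open>h > 0\<close> in \<open>auto simp: algebra_simps\<close>)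
  then obtain s where s: "0 < s" "s < h"
    and \<phi>: "\<phi> h - \<phi> 0 = (h - 0) * (?g' ((x + h *\<^sub>R v) + s *\<^sub>R u) u - ?g' (x + s *\<^sub>R u) u)"
    using MVT2[OF \<open>h > 0\<close>, of \<phi>
        "\<lambda>s. ?g' ((x + h *\<^sub>R v) + s *\<^sub>R u) u - ?g' (x + s *\<^sub>R u) u"] by blast
  \<comment> \<open>With \<open>s\<close> now fixed, the bracket obtained from \<open>\<phi>\<close>
    is itself an increment along \<open>v\<close>, namely
    \<open>\<psi> h - \<psi> 0\<close>.\<close>
  define \<psi> where "\<psi> t = ?g' ((x + s *\<^sub>R u) + t *\<^sub>R v) u" for t
  have "(\<psi> has_real_derivative frechet_derivative (\<lambda>y. ?g' y u) (at ((x + s *\<^sub>R u) + t *\<^sub>R v)) v) (at t)"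
    if "0 \<le> t" "t \<le> h" for t
    unfolding \<psi>_def
    by (rule line[where G = "\<lambda>y. ?g' y u", OF g']) (use S[of s t] s that in auto)
  then obtain t where t: "0 < t" "t < h"
    and \<psi>: "\<psi> h - \<psi> 0 = (h - 0) * frechet_derivative (\<lambda>y. ?g' y u) (at ((x + s *\<^sub>R u) + t *\<^sub>R v)) v"
    using MVT2[OF \<open>h > 0\<close>, of \<psi>
        "\<lambda>t. frechet_derivative (\<lambda>y. ?g' y u) (at ((x + s *\<^sub>R u) + t *\<^sub>R v)) v"] by blast
  have "\<phi> h - \<phi> 0 = h * (\<psi> h - \<psi> 0)"
    using \<phi> by (simp add: \<psi>_def ac_simps)
  also have "\<dots> = h\<^sup>2 * frechet_derivative (\<lambda>y. ?g' y u) (at (x + s *\<^sub>R u + t *\<^sub>R v)) v"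
    unfolding \<psi> by (simp add: power2_eq_square)
  finally show thesis
    by (intro that[of s t]) (use s t in \<open>simp_all add: \<phi>_def algebra_simps\<close>)
qed

text \<open>The same second difference is computed in both orders, so the two mixed derivatives
  agree at two possibly different points of one small parallelogram. Both derivatives are continuous
  at \<open>x\<close>, and shrinking the parallelogram gives equality there.\<close>

lemma mixed_derivatives_commute:
  fixes g :: "'a::real_normed_vector \<Rightarrow> real"
  assumes "open S" and "Cr_on 2 S g" and "x \<in> S"
  shows "frechet_derivative (\<lambda>y. frechet_derivative g (at y) u) (at x) v
       = frechet_derivative (\<lambda>y. frechet_derivative g (at y) v) (at x) u"
proof -
  define D where "D u v y = frechet_derivative (\<lambda>y. frechet_derivative g (at y) u) (at y) v" for u v y
  have cont: "isCont (D u v) x" for u v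
    using assms by (auto simp: numeral_2_eq_2 D_def[abs_def] continuous_on_eq_continuous_at)
  have "\<bar>D u v x - D v u x\<bar> \<le> 2 * e" if "e > 0" for e
  proof -
    obtain d1 where d1: "d1 > 0" "\<And>y. dist y x < d1 \<Longrightarrow> \<bar>D u v y - D u v x\<bar> < e"
      using cont[of u v] \<open>e > 0\<close> unfolding continuous_at_eps_delta dist_real_def by metis
    obtain d2 where d2: "d2 > 0" "\<And>y. dist y x < d2 \<Longrightarrow> \<bar>D v u y - D v u x\<bar> < e"
      using cont[of v u] \<open>e > 0\<close> unfolding continuous_at_eps_delta dist_real_def by metis
    obtain d3 where d3: "d3 > 0" "\<And>y. dist y x < d3 \<Longrightarrow> y \<in> S"
      using assms by (auto simp: open_dist)
    define d where "d = min d1 (min d2 d3)"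
    \<comment> \<open>Chosen so that the whole parallelogram of side parameters at most
      \<open>h\<close> lies within distance \<open>d\<close> of \<open>x\<close>; the summand 1
      keeps the denominator positive when \<open>u\<close> and \<open>v\<close> both vanish.\<close>
    define h where "h = d / (norm u + norm v + 1)"
    have "d > 0" "h > 0"
      using d1(1) d2(1) d3(1) by (auto simp: d_def h_def add_nonneg_pos)
    have near: "dist (x + s *\<^sub>R u + t *\<^sub>R v) x < d" if "0 \<le> s" "s \<le> h" "0 \<le> t" "t \<le> h" for s t
    proof -
      have "dist (x + s *\<^sub>R u + t *\<^sub>R v) x \<le> s * norm u + t * norm v"
        using norm_triangle_ineq[of "s *\<^sub>R u" "t *\<^sub>R v"] that by (simp add: dist_norm algebra_simps)
      also have "\<dots> \<le> h * norm u + h * norm v"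
        using that by (intro add_mono mult_right_mono) auto
      also have "\<dots> < h * (norm u + norm v + 1)"
        using \<open>h > 0\<close> by (simp add: algebra_simps)
      also have "\<dots> = d"
        using norm_ge_zero[of u] norm_ge_zero[of v] by (simp add: h_def add_nonneg_eq_0_iff)
      finally show ?thesis .
    qed
    have near': "dist (x + s *\<^sub>R v + t *\<^sub>R u) x < d" if "0 \<le> s" "s \<le> h" "0 \<le> t" "t \<le> h" for s t
      using near[of t s] that by (simp add: ac_simps)
    obtain s t where st: "0 \<le> s" "s \<le> h" "0 \<le> t" "t \<le> h"
      and "g (x + h *\<^sub>R u + h *\<^sub>R v) - g (x + h *\<^sub>R u) - g (x + h *\<^sub>R v) + g x
        = h\<^sup>2 * D u v (x + s *\<^sub>R u + t *\<^sub>R v)"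
      using second_difference_mvt[OF assms(2) \<open>h > 0\<close>, of x u v] near d3 unfolding D_def d_def by auto
    moreover obtain s' t' where st': "0 \<le> s'" "s' \<le> h" "0 \<le> t'" "t' \<le> h"
      and "g (x + h *\<^sub>R v + h *\<^sub>R u) - g (x + h *\<^sub>R v) - g (x + h *\<^sub>R u) + g x
        = h\<^sup>2 * D v u (x + s' *\<^sub>R v + t' *\<^sub>R u)"
      using second_difference_mvt[OF assms(2) \<open>h > 0\<close>, of x v u] near' d3 unfolding D_def d_def by auto
    ultimately have "h\<^sup>2 * D u v (x + s *\<^sub>R u + t *\<^sub>R v) = h\<^sup>2 * D v u (x + s' *\<^sub>R v + t' *\<^sub>R u)"
      by (simp add: algebra_simps)
    then have "D u v (x + s *\<^sub>R u + t *\<^sub>R v) = D v u (x + s' *\<^sub>R v + t' *\<^sub>R u)"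
      using \<open>h > 0\<close> by simp
    moreover have "\<bar>D u v (x + s *\<^sub>R u + t *\<^sub>R v) - D u v x\<bar> < e"
      using near[OF st] d1 by (simp add: d_def)
    moreover have "\<bar>D v u (x + s' *\<^sub>R v + t' *\<^sub>R u) - D v u x\<bar> < e"
      using near'[OF st'] d2 by (simp add: d_def)
    ultimately show ?thesis by linarith
  qed
  \<comment> \<open>A nonzero difference would be bounded by two thirds of itself.\<close>
  from this[of "\<bar>D u v x - D v u x\<bar> / 3"] have "D u v x = D v u x"
    by (cases "D u v x = D v u x") auto
  then show ?thesis by (simp add: D_def)
qed

section \<open>Linear algebra of the restricted matrix and the bracket matrix\<close>

lemma det_nonzero_iff_trivial_kernel:
  fixes A :: "real ^ 'n ^ 'n"
  shows "det A \<noteq> 0 \<longleftrightarrow> (\<forall>x. A *v x = 0 \<longrightarrow> x = 0)"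
  unfolding invertible_det_nz[symmetric] invertible_left_inverse matrix_left_invertible_ker ..

lemma matrix_vector_mult_matrix_inv:
  fixes W :: "real ^ 'n ^ 'n"
  assumes "det W \<noteq> 0"
  shows "W *v (matrix_inv W *v x) = x" and "matrix_inv W *v (W *v x) = x"
proof -
  \<comment> \<open>\<open>matrix_inv\<close> is defined by choice; invertibility supplies the
    witness that makes the chosen matrix a two-sided inverse.\<close>
  have "W ** matrix_inv W = mat 1 \<and> matrix_inv W ** W = mat 1"
    using assms unfolding invertible_det_nz[symmetric] invertible_def matrix_inv_def by (rule someI_ex)
  then show "W *v (matrix_inv W *v x) = x" and "matrix_inv W *v (W *v x) = x"
    by (simp_all add: matrix_vector_mul_assoc)
qed

text \<open>The four conditions on \<open>F\<close> and \<open>T\<close> say that \<open>T\<close>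
  followed by \<open>F\<close> is a short exact sequence, and likewise \<open>transpose F\<close>
  followed by \<open>transpose T\<close>. Exactness in the middle is what carries a kernel vector
  from one matrix to the other, and injectivity keeps it nonzero.\<close>

lemma det_restriction_nonzero_iff:
  fixes W :: "real ^ 'n ^ 'n" and F :: "real ^ 'n ^ 'm" and T :: "real ^ 'k ^ 'n"
  assumes W: "det W \<noteq> 0"
    and kerF: "\<And>v. F *v v = 0 \<longleftrightarrow> v \<in> range ((*v) T)"
    and kerT: "\<And>p. transpose T *v p = 0 \<longleftrightarrow> p \<in> range ((*v) (transpose F))"
    and injT: "\<And>x. T *v x = 0 \<Longrightarrow> x = 0"
    and injF: "\<And>y. transpose F *v y = 0 \<Longrightarrow> y = 0"
  shows "det (transpose T ** W ** T) \<noteq> 0 \<longleftrightarrow> det (F ** matrix_inv W ** transpose F) \<noteq> 0"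
proof -
  note inv = matrix_vector_mult_matrix_inv[OF W]
  have "(\<exists>x. transpose T *v (W *v (T *v x)) = 0 \<and> x \<noteq> 0)
    \<longleftrightarrow> (\<exists>y. F *v (matrix_inv W *v (transpose F *v y)) = 0 \<and> y \<noteq> 0)"
  proof (intro iffI; elim exE conjE)
    fix x assume "transpose T *v (W *v (T *v x)) = 0" and "x \<noteq> 0"
    then obtain y where y: "W *v (T *v x) = transpose F *v y"
      using kerT by blast
    then have "T *v x = matrix_inv W *v (transpose F *v y)"
      using inv(2) by metis
    moreover have "F *v (T *v x) = 0" using kerF by blast
    moreover have "T *v x \<noteq> 0" using injT \<open>x \<noteq> 0\<close> by blast
    ultimately show "\<exists>y. F *v (matrix_inv W *v (transpose F *v y)) = 0 \<and> y \<noteq> 0"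
      by (intro exI[of _ y]) auto
  next
    fix y assume "F *v (matrix_inv W *v (transpose F *v y)) = 0" and "y \<noteq> 0"
    then obtain x where x: "matrix_inv W *v (transpose F *v y) = T *v x"
      using kerF by blast
    then have "W *v (T *v x) = transpose F *v y"
      using inv(1) by metis
    moreover have "transpose T *v (transpose F *v y) = 0" using kerT by blast
    moreover have "transpose F *v y \<noteq> 0" using injF \<open>y \<noteq> 0\<close> by blast
    ultimately show "\<exists>x. transpose T *v (W *v (T *v x)) = 0 \<and> x \<noteq> 0"
      by (intro exI[of _ x]) auto
  qed
  then show ?thesis
    unfolding det_nonzero_iff_trivial_kernel matrix_vector_mul_assoc matrix_mul_assoc by blast
qed

lemma sum_UNIV_Plus:
  fixes g :: "'a::finite + 'b::finite \<Rightarrow> 'c::comm_monoid_add"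
  shows "sum g UNIV = (\<Sum>\<alpha>\<in>UNIV. g (Inl \<alpha>)) + (\<Sum>a\<in>UNIV. g (Inr a))"
  using sum.Plus[of "UNIV :: 'a set" "UNIV :: 'b set" g] by (simp add: comp_def)

text \<open>Supplies the exactness conditions for a graph. A kernel vector is corrected by an
  element of the expected image until one of its two blocks vanishes; on the other block the matrix
  acts invertibly, so the remainder is zero.\<close>

lemma graph_tangent_kernels:
  fixes F :: "real ^ ('m::finite + 'k::finite) ^ 'm" and T :: "real ^ 'k ^ ('m + 'k)"
  assumes FT: "F ** T = 0"
    and B: "det (\<chi> \<alpha> \<beta>. F $ \<alpha> $ Inl \<beta>) \<noteq> 0"
    and T: "\<And>a b. T $ Inr a $ b = (if a = b then 1 else 0)"
  shows "F *v v = 0 \<longleftrightarrow> v \<in> range ((*v) T)"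
    and "transpose T *v p = 0 \<longleftrightarrow> p \<in> range ((*v) (transpose F))"
    and "T *v x = 0 \<Longrightarrow> x = 0"
    and "transpose F *v y = 0 \<Longrightarrow> y = 0"
proof -
  define B where "B = (\<chi> \<alpha> \<beta>. F $ \<alpha> $ Inl \<beta>)"
  have TR: "(T *v x) $ Inr a = x $ a" for x a
    by (simp add: matrix_vector_mult_def T if_distrib[of "\<lambda>c. c * _"] cong: if_cong)
  have FL: "(transpose F *v y) $ Inl \<beta> = (transpose B *v y) $ \<beta>" for y \<beta>
    by (simp add: matrix_vector_mult_def transpose_def B_def)
  have TF: "transpose T ** transpose F = 0"
    unfolding matrix_transpose_mul[symmetric] FT by (simp add: vec_eq_iff transpose_def)
  have detB: "det B \<noteq> 0" using B by (simp add: B_def)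
  then have kerB: "B *v u = 0 \<Longrightarrow> u = 0" for u
    using det_nonzero_iff_trivial_kernel by blast
  have detBt: "det (transpose B) \<noteq> 0" using detB by (simp add: det_transpose)
  then have kerBt: "transpose B *v u = 0 \<Longrightarrow> u = 0" for u
    using det_nonzero_iff_trivial_kernel by blast
  show "F *v v = 0 \<longleftrightarrow> v \<in> range ((*v) T)"
  proof
    assume v: "F *v v = 0"
    \<comment> \<open>The \<open>Inr\<close> block of \<open>T\<close> is the identity, so the
      subtracted vector has the same \<open>Inr\<close> part as \<open>v\<close>. What is left lives
      on the \<open>Inl\<close> block, where \<open>F\<close> acts as \<open>B\<close>.\<close>
    define u where "u = v - T *v (\<chi> a. v $ Inr a)"
    have uR: "u $ Inr a = 0" for a by (simp add: u_def TR)
    have "F *v u = 0"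
      by (simp add: u_def v FT matrix_vector_mult_diff_distrib matrix_vector_mul_assoc)
    moreover have "F *v u = B *v (\<chi> \<alpha>. u $ Inl \<alpha>)"
      by (simp add: vec_eq_iff matrix_vector_mult_def sum_UNIV_Plus uR B_def)
    ultimately have "(\<chi> \<alpha>. u $ Inl \<alpha>) = 0" using kerB by simp
    with uR have "u $ i = 0" for i by (cases i) (auto simp: vec_eq_iff)
    then have "u = 0" by (simp add: vec_eq_iff)
    then show "v \<in> range ((*v) T)" by (auto simp: u_def)
  qed (auto simp: matrix_vector_mul_assoc FT)
  show "transpose T *v p = 0 \<longleftrightarrow> p \<in> range ((*v) (transpose F))"
  proof
    assume p: "transpose T *v p = 0"
    \<comment> \<open>Solves for the \<open>Inl\<close> part of \<open>p\<close>, on which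
      \<open>transpose F\<close> acts through \<open>transpose B\<close>. The remainder
      \<open>q\<close> lives on the \<open>Inr\<close> block, where \<open>transpose T\<close> acts
      as the identity.\<close>
    define y where "y = matrix_inv (transpose B) *v (\<chi> \<alpha>. p $ Inl \<alpha>)"
    define q where "q = p - transpose F *v y"
    have qL: "q $ Inl \<alpha> = 0" for \<alpha>
      by (simp add: q_def FL y_def matrix_vector_mult_matrix_inv[OF detBt] del: transpose_matrix_vector)
    have "transpose T *v q = 0"
      by (simp add: q_def p matrix_vector_mult_diff_distrib matrix_vector_mul_assoc TF
          del: transpose_matrix_vector)
    moreover have "(transpose T *v q) $ a = q $ Inr a" for a
      by (simp add: matrix_vector_mult_def transpose_def sum_UNIV_Plus qL T if_distrib[of "\<lambda>c. c * _"] cong: if_cong)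
    ultimately have qR: "q $ Inr a = 0" for a by (metis zero_index)
    have "q $ i = 0" for i using qL qR by (cases i) auto
    then have "q = 0" by (simp add: vec_eq_iff)
    then show "p \<in> range ((*v) (transpose F))" by (auto simp: q_def)
  next
    assume "p \<in> range ((*v) (transpose F))"
    then show "transpose T *v p = 0"
      by (auto simp: matrix_vector_mul_assoc TF simp del: transpose_matrix_vector)
  qed
  show "x = 0" if "T *v x = 0"
    using TR[of x] that by (simp add: vec_eq_iff)
  show "y = 0" if "transpose F *v y = 0"
    by (rule kerBt) (use FL[of y] that in \<open>simp add: vec_eq_iff\<close>)
qed

section \<open>Differentiability classes and the chain rule in coordinates\<close>

text \<open>On an open set, agreement holds near every point, so the Frechet derivatives agree as
  well and the induction passes to the directional derivatives.\<close>

lemma Cr_on_cong: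
  assumes "open S" and "\<And>x. x \<in> S \<Longrightarrow> F x = G x" and "Cr_on r S F"
  shows "Cr_on r S G"
  using assms(2,3)
proof (induction r arbitrary: F G)
  case 0
  then show ?case by (simp cong: continuous_on_cong)
next
  case (Suc r)
  have eq: "frechet_derivative F (at x) = frechet_derivative G (at x)" if "x \<in> S" for x
    using Suc.prems assms(1) that by (intro frechet_derivative_transform_within_open[of F x S G]) auto
  have "Cr_on r S (\<lambda>x. frechet_derivative G (at x) v)" for v
    by (rule Suc.IH[of "\<lambda>x. frechet_derivative F (at x) v"]) (use Suc.prems eq in auto)
  moreover have "G differentiable (at x)" if "x \<in> S" for x
  proof -
    have "(F has_derivative frechet_derivative F (at x)) (at x)"
      using Suc.prems that by (simp add: frechet_derivative_works[symmetric])
    then have "(G has_derivative frechet_derivative F (at x)) (at x)"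
      using has_derivative_transform_within_open assms(1) that Suc.prems(1) by blast
    then show ?thesis unfolding differentiable_def by blast
  qed
  ultimately show ?case by simp
qed

text \<open>\<open>L\<close> commutes with differentiation, so each directional derivative of the
  composite is again \<open>L\<close> applied to a function of class one lower.\<close>

lemma Cr_on_bounded_linear:
  assumes "bounded_linear L" and "open S" and "Cr_on r S F"
  shows "Cr_on r S (\<lambda>x. L (F x))"
  using assms(3)
proof (induction r arbitrary: F)
  case 0
  then show ?case by (simp add: bounded_linear.continuous_on[OF assms(1)])
next
  case (Suc r)
  have deriv: "((\<lambda>x. L (F x)) has_derivative (\<lambda>v. L (frechet_derivative F (at x) v))) (at x)"
    if "x \<in> S" for x
    using Suc.prems that
    by (intro bounded_linear.has_derivative[OF assms(1)]) (simp add: frechet_derivative_works[symmetric])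
  have "Cr_on r S (\<lambda>x. frechet_derivative (\<lambda>x. L (F x)) (at x) v)" for v
  proof (rule Cr_on_cong[OF assms(2)])
    show "Cr_on r S (\<lambda>x. L (frechet_derivative F (at x) v))"
      using Suc by simp
    show "L (frechet_derivative F (at x) v) = frechet_derivative (\<lambda>x. L (F x)) (at x) v" if "x \<in> S" for x
      using fun_cong[OF frechet_derivative_at[OF deriv[OF that]], of v] .
  qed
  moreover have "(\<lambda>x. L (F x)) differentiable (at x)" if "x \<in> S" for x
    using deriv[OF that] unfolding differentiable_def by blast
  ultimately show ?case by simp
qed

lemma smooth_on_imp_differentiable: "smooth_on S F \<Longrightarrow> x \<in> S \<Longrightarrow> F differentiable (at x)"
  unfolding smooth_on_def by (metis Cr_on.simps(2))

lemma pderiv_at_eqI: "(F has_derivative F') (at z) \<Longrightarrow> pderiv_at i F z = F' (axis i 1)"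
  by (simp add: pderiv_at_def frechet_derivative_at[symmetric])

lemma has_derivative_pderiv_at:
  assumes "F differentiable (at z)"
  shows "(F has_derivative (\<lambda>v. \<Sum>i\<in>UNIV. pderiv_at i F z * v $ i)) (at z)"
proof -
  have F: "(F has_derivative frechet_derivative F (at z)) (at z)"
    using assms frechet_derivative_works by blast
  then have lin: "linear (frechet_derivative F (at z))" by (rule has_derivative_linear)
  have "frechet_derivative F (at z) v = (\<Sum>i\<in>UNIV. pderiv_at i F z * v $ i)" for v
  proof -
    have "frechet_derivative F (at z) v = frechet_derivative F (at z) (\<Sum>i\<in>UNIV. v $ i *s axis i 1)"
      by (simp add: basis_expansion)
    also have "\<dots> = (\<Sum>i\<in>UNIV. pderiv_at i F z * v $ i)"
      by (simp add: linear_sum[OF lin] scalar_mult_eq_scaleR linear_scale[OF lin] pderiv_at_def mult.commute)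
    finally show ?thesis .
  qed
  with F show ?thesis by (metis (no_types, lifting) ext)
qed

lemma has_derivative_vecI:
  fixes e :: "'a::real_normed_vector \<Rightarrow> real ^ 'n::finite"
  assumes "\<And>i. ((\<lambda>y. e y $ i) has_derivative (\<lambda>v. e' v $ i)) (at x)"
  shows "(e has_derivative e') (at x)"
  unfolding has_derivative_componentwise_within[of e]
  using assms by (auto simp: Basis_vec_def inner_axis)

lemma pderiv_at_compose:
  fixes e :: "real ^ 'k::finite \<Rightarrow> real ^ 'n::finite"
  assumes "\<And>i. (\<lambda>y. e y $ i) differentiable (at x)" and "g differentiable (at (e x))"
  shows "pderiv_at a (\<lambda>y. g (e y)) x
    = (\<Sum>i\<in>UNIV. pderiv_at i g (e x) * pderiv_at a (\<lambda>y. e y $ i) x)"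
proof -
  have "(e has_derivative (\<lambda>v. \<chi> i. frechet_derivative (\<lambda>y. e y $ i) (at x) v)) (at x)"
    using assms(1) by (intro has_derivative_vecI) (simp add: frechet_derivative_works[symmetric])
  from has_derivative_compose[OF this has_derivative_pderiv_at[OF assms(2)]]
  show ?thesis by (subst pderiv_at_eqI) (auto simp: pderiv_at_def)
qed

lemma differentiable_compose_vec:
  fixes e :: "real ^ 'k::finite \<Rightarrow> real ^ 'n::finite"
  assumes "\<And>i. (\<lambda>y. e y $ i) differentiable (at x)" and "g differentiable (at (e x))"
  shows "(\<lambda>y. g (e y)) differentiable (at x)"
proof -
  have "(e has_derivative (\<lambda>v. \<chi> i. frechet_derivative (\<lambda>y. e y $ i) (at x) v)) (at x)"
    using assms(1) by (intro has_derivative_vecI) (simp add: frechet_derivative_works[symmetric])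
  then show ?thesis
    using assms(2) has_derivative_compose unfolding differentiable_def by blast
qed

lemma Cr_on_graph_embedding:
  fixes V :: "(real ^ 'k::finite) set" and f :: "real ^ 'k \<Rightarrow> real ^ 'm::finite"
  assumes "open V" and "smooth_on V f"
  shows "Cr_on r V (\<lambda>y. graph_embedding f y $ i)"
proof (cases i)
  case (Inl \<alpha>)
  then show ?thesis
    using Cr_on_bounded_linear[OF bounded_linear_vec_nth \<open>open V\<close>, of r f \<alpha>] assms(2)
    by (auto simp: graph_embedding_def smooth_on_def)
next
  case (Inr a)
  have const: "Cr_on s V (\<lambda>_. c)" for s and c :: real
    by (induction s arbitrary: c) simp_all
  have "((\<lambda>y. y $ a) has_derivative (\<lambda>y. y $ a)) (at x)" for x :: "real ^ 'k"
    by (rule bounded_linear_imp_has_derivative) (rule bounded_linear_vec_nth)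
  then have "(\<lambda>y. y $ a) differentiable (at x)" "frechet_derivative (\<lambda>y. y $ a) (at x) = (\<lambda>y. y $ a)" for x :: "real ^ 'k"
    by (auto simp: differentiable_def frechet_derivative_at[symmetric])
  \<comment> \<open>A case split on \<open>r\<close> suffices: the directional derivatives of a
    coordinate function are constants, covered to every order by \<open>const\<close>.\<close>
  then have "Cr_on r V (\<lambda>y. y $ a)"
    by (cases r) (auto simp: const intro!: continuous_intros)
  then show ?thesis
    using Inr by (simp add: graph_embedding_def)
qed

section \<open>Pullbacks of closed forms\<close>

text \<open>Cyclic renaming of summation indices, used to bring the three terms of the closedness
  identity over common Jacobian factors.\<close>

lemma sum_rotate3:
  "(\<Sum>l\<in>A. \<Sum>i\<in>A. \<Sum>j\<in>A. g l i j) = (\<Sum>l\<in>A. \<Sum>i\<in>A. \<Sum>j\<in>A. g i j l)"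
proof -
  have "(\<Sum>l\<in>A. \<Sum>i\<in>A. \<Sum>j\<in>A. g i j l) = (\<Sum>i\<in>A. \<Sum>l\<in>A. \<Sum>j\<in>A. g i j l)"
    by (rule sum.swap)
  also have "\<dots> = (\<Sum>i\<in>A. \<Sum>j\<in>A. \<Sum>l\<in>A. g i j l)"
    by (intro sum.cong refl sum.swap)
  finally show ?thesis ..
qed

text \<open>The product rule splits each derivative into terms with second derivatives of
  \<open>e\<close> and a term with first derivatives of \<open>\<omega>\<close>. In the cyclic sum
  the former cancel in pairs by symmetry of second derivatives, and the latter add up to the
  closedness identity of \<open>\<omega>\<close> contracted with three Jacobian factors.\<close>

lemma closed_form_on_pullback:
  fixes e :: "real ^ 'k::finite \<Rightarrow> real ^ 'n::finite" and \<omega> :: "real ^ 'n \<Rightarrow> real ^ 'n ^ 'n"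
  assumes "open V" and e2: "\<And>i. Cr_on 2 V (\<lambda>x. e x $ i)" and "e ` V \<subseteq> M"
    and diff\<omega>: "\<And>z. z \<in> M \<Longrightarrow> \<omega> differentiable (at z)"
    and skew: "\<And>z i j. z \<in> M \<Longrightarrow> \<omega> z $ i $ j = - \<omega> z $ j $ i"
    and closed: "closed_form_on M \<omega>"
  shows "closed_form_on V (\<lambda>x. \<chi> a b. \<Sum>i\<in>UNIV. \<Sum>j\<in>UNIV.
     pderiv_at a (\<lambda>y. e y $ i) x * pderiv_at b (\<lambda>y. e y $ j) x * \<omega> (e x) $ i $ j)"
  unfolding closed_form_on_def
proof (intro ballI allI)
  fix x a b c assume "x \<in> V"
  then have M: "e x \<in> M" using assms(3) by blast
  \<comment> \<open>\<open>T\<close> is kept as a function of the point because it is differentiated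
    again to give \<open>H\<close>; \<open>W\<close> and \<open>dW\<close> are frozen at
    \<open>e x\<close>.\<close>
  define T where "T a i = pderiv_at a (\<lambda>y. e y $ i)" for a i
  define H where "H c a i = pderiv_at c (T a i) x" for c a i
  define W where "W i j = \<omega> (e x) $ i $ j" for i j
  define dW where "dW l i j = pderiv_at l (\<lambda>z. \<omega> z $ i $ j) (e x)" for l i j
  have e_diff: "(\<lambda>y. e y $ i) differentiable (at x)" for i
    using e2[of i] \<open>x \<in> V\<close> by (simp add: numeral_2_eq_2)
  have T_eq: "T a i = (\<lambda>y. frechet_derivative (\<lambda>y. e y $ i) (at y) (axis a 1))" for a i
    by (simp add: T_def pderiv_at_def fun_eq_iff)
  have T_diff: "T a i differentiable (at x)" for a i
    using e2[of i] \<open>x \<in> V\<close> by (simp add: numeral_2_eq_2 T_eq)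
  have W_skew: "W i j = - W j i" for i j
    unfolding W_def by (rule skew[OF M])
  have T_deriv: "(T a i has_derivative frechet_derivative (T a i) (at x)) (at x)" for a i
    using T_diff frechet_derivative_works by blast
  have H_sym: "H c a i = H a c i" for a c i
    unfolding H_def T_eq pderiv_at_def
    by (rule mixed_derivatives_commute[OF \<open>open V\<close> e2 \<open>x \<in> V\<close>])
  have W_diff: "(\<lambda>z. \<omega> z $ i $ j) differentiable (at (e x))" for i j
  proof -
    have "bounded_linear (\<lambda>A :: real ^ 'n ^ 'n. A $ i $ j)"
      by (intro bounded_linear_compose[OF bounded_linear_vec_nth bounded_linear_vec_nth])
    then show ?thesis
      using diff\<omega>[OF M] bounded_linear.has_derivative unfolding differentiable_def by blast
  qed
  have We_deriv: "((\<lambda>y. \<omega> (e y) $ i $ j) has_derivative frechet_derivative (\<lambda>y. \<omega> (e y) $ i $ j) (at x)) (at x)"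
    for i j
    by (rule iffD1[OF frechet_derivative_works],
        rule differentiable_compose_vec[where e = e and x = x and g = "\<lambda>z. \<omega> z $ i $ j", OF e_diff W_diff])
  have dWe: "pderiv_at c (\<lambda>y. \<omega> (e y) $ i $ j) x = (\<Sum>l\<in>UNIV. T c l x * dW l i j)" for c i j
    unfolding T_def dW_def
    by (subst pderiv_at_compose[where e = e and x = x and g = "\<lambda>z. \<omega> z $ i $ j", OF e_diff W_diff])
      (simp add: mult.commute)
  define S where "S c a b = (\<Sum>i\<in>UNIV. \<Sum>j\<in>UNIV. H c a i * T b j x * W i j)" for c a b
  define R where "R c a b = (\<Sum>l\<in>UNIV. \<Sum>i\<in>UNIV. \<Sum>j\<in>UNIV. T c l x * T a i x * T b j x * dW l i j)"
    for c a b
  have "pderiv_at c (\<lambda>y. \<Sum>i\<in>UNIV. \<Sum>j\<in>UNIV. T a i y * T b j y * \<omega> (e y) $ i $ j) x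
    = S c a b - S c b a + R c a b" for a b c
  proof -
    have deriv: "((\<lambda>y. \<Sum>i\<in>UNIV. \<Sum>j\<in>UNIV. T a i y * T b j y * \<omega> (e y) $ i $ j) has_derivative
      (\<lambda>v. \<Sum>i\<in>UNIV. \<Sum>j\<in>UNIV.
        T a i x * T b j x * frechet_derivative (\<lambda>y. \<omega> (e y) $ i $ j) (at x) v
          + (T a i x * frechet_derivative (T b j) (at x) v
            + frechet_derivative (T a i) (at x) v * T b j x) * \<omega> (e x) $ i $ j)) (at x)"
      by (intro has_derivative_sum has_derivative_mult T_deriv We_deriv)
    have "pderiv_at c (\<lambda>y. \<Sum>i\<in>UNIV. \<Sum>j\<in>UNIV. T a i y * T b j y * \<omega> (e y) $ i $ j) x
      = (\<Sum>i\<in>UNIV. \<Sum>j\<in>UNIV. T a i x * T b j x * pderiv_at c (\<lambda>y. \<omega> (e y) $ i $ j) x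
          + (T a i x * H c b j + H c a i * T b j x) * W i j)"
      unfolding H_def W_def
      by (subst pderiv_at_eqI[OF deriv]) (simp only: pderiv_at_def)
    also have "\<dots> = S c a b + (\<Sum>i\<in>UNIV. \<Sum>j\<in>UNIV. T a i x * H c b j * W i j)
        + (\<Sum>i\<in>UNIV. \<Sum>j\<in>UNIV. T a i x * T b j x * (\<Sum>l\<in>UNIV. T c l x * dW l i j))"
      by (simp add: dWe S_def sum.distrib algebra_simps)
    \<comment> \<open>Exchanging the names of \<open>i\<close> and \<open>j\<close> transposes
      \<open>W\<close>, and skew symmetry produces the sign.\<close>
    also have "(\<Sum>i\<in>UNIV. \<Sum>j\<in>UNIV. T a i x * H c b j * W i j) = - S c b a"
      unfolding S_def sum_negf[symmetric]
      by (subst sum.swap, intro sum.cong refl, subst W_skew) simp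
    also have "(\<Sum>i\<in>UNIV. \<Sum>j\<in>UNIV. T a i x * T b j x * (\<Sum>l\<in>UNIV. T c l x * dW l i j)) = R c a b"
    proof -
      have "R c a b = (\<Sum>i\<in>UNIV. \<Sum>j\<in>UNIV. \<Sum>l\<in>UNIV. T c l x * T a i x * T b j x * dW l i j)"
        unfolding R_def by (rule sum_rotate3[symmetric])
      then show ?thesis by (simp add: sum_distrib_left mult_ac)
    qed
    finally show ?thesis by simp
  qed
  moreover have "S c a b = S a c b" for a b c
    unfolding S_def using H_sym by metis
  moreover have "R a b c + R b c a + R c a b = 0"
  proof -
    \<comment> \<open>After the renaming all three sums carry the factors \<open>T a l\<close>,
      \<open>T b i\<close>, \<open>T c j\<close> at \<open>x\<close>, and only the indices of
      \<open>dW\<close> are cycled.\<close>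
    have "R b c a = (\<Sum>l\<in>UNIV. \<Sum>i\<in>UNIV. \<Sum>j\<in>UNIV. T b i x * T c j x * T a l x * dW i j l)"
      unfolding R_def
      by (rule sum_rotate3)
    moreover have "R c a b = (\<Sum>l\<in>UNIV. \<Sum>i\<in>UNIV. \<Sum>j\<in>UNIV. T c j x * T a l x * T b i x * dW j l i)"
      unfolding R_def
      by (rule trans[OF sum_rotate3 sum_rotate3])
    ultimately have "R a b c + R b c a + R c a b
      = (\<Sum>l\<in>UNIV. \<Sum>i\<in>UNIV. \<Sum>j\<in>UNIV. T a l x * T b i x * T c j x * (dW l i j + dW i j l + dW j l i))"
      by (simp add: R_def sum.distrib algebra_simps)
    also have "\<dots> = 0"
      using closed M by (simp add: closed_form_on_def dW_def)
    finally show ?thesis .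
  qed
  ultimately show "pderiv_at a (\<lambda>x. (\<chi> a b. \<Sum>i\<in>UNIV. \<Sum>j\<in>UNIV.
      pderiv_at a (\<lambda>y. e y $ i) x * pderiv_at b (\<lambda>y. e y $ j) x * \<omega> (e x) $ i $ j) $ b $ c) x
    + pderiv_at b (\<lambda>x. (\<chi> a b. \<Sum>i\<in>UNIV. \<Sum>j\<in>UNIV.
      pderiv_at a (\<lambda>y. e y $ i) x * pderiv_at b (\<lambda>y. e y $ j) x * \<omega> (e x) $ i $ j) $ c $ a) x
    + pderiv_at c (\<lambda>x. (\<chi> a b. \<Sum>i\<in>UNIV. \<Sum>j\<in>UNIV.
      pderiv_at a (\<lambda>y. e y $ i) x * pderiv_at b (\<lambda>y. e y $ j) x * \<omega> (e x) $ i $ j) $ a $ b) x = 0"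
    by (simp add: T_def)
qed

section \<open>Matrix form of both sides and conclusion\<close>

lemma pderiv_at_graph_embedding_Inr:
  "pderiv_at a (\<lambda>y. graph_embedding f y $ Inr b) x = (if b = a then 1 else 0)"
proof -
  have "((\<lambda>y. y $ b) has_derivative (\<lambda>y. y $ b)) (at x)"
    by (rule bounded_linear_imp_has_derivative) (rule bounded_linear_vec_nth)
  then show ?thesis
    by (simp add: graph_embedding_def pderiv_at_eqI axis_def)
qed

lemma restricted_form_eq_matrix_product:
  "restricted_form w f x =
    transpose (\<chi> i a. pderiv_at a (\<lambda>y. graph_embedding f y $ i) x) ** w (graph_embedding f x)
      ** (\<chi> i a. pderiv_at a (\<lambda>y. graph_embedding f y $ i) x)"
  unfolding restricted_form_def matrix_matrix_mult_def transpose_def vec_eq_iff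
  \<comment> \<open>The left-nested matrix product sums over the second index of \<open>w\<close>
    outermost, opposite to the definition.\<close>
  by (subst sum.swap) (simp add: sum_distrib_left sum_distrib_right ac_simps)

lemma poisson_bracket_eq_matrix_product:
  "(\<chi> \<alpha> \<beta>. poisson_bracket w (A \<alpha>) (B \<beta>) z) =
    (\<chi> \<alpha> i. pderiv_at i (A \<alpha>) z) ** matrix_inv (w z) ** transpose (\<chi> \<alpha> i. pderiv_at i (B \<alpha>) z)"
  unfolding poisson_bracket_def matrix_matrix_mult_def transpose_def vec_eq_iff
  by (subst sum.swap) (simp add: sum_distrib_left sum_distrib_right ac_simps)

theorem mainTheorem1:
  fixes M :: "(real ^ ('m::finite + 'k::finite)) set"
    and \<omega> :: "real ^ ('m + 'k) \<Rightarrow> real ^ ('m + 'k) ^ ('m + 'k)"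
    and \<Phi> :: "real ^ ('m + 'k) \<Rightarrow> real ^ 'm"
    and V :: "(real ^ 'k) set"
    and f :: "real ^ 'k \<Rightarrow> real ^ 'm"
  defines "N \<equiv> {z \<in> M. \<forall>\<alpha>. \<Phi> z $ \<alpha> = 0}"
  assumes "even CARD('m + 'k)" and "even CARD('k)"
    and "open M" and "symplectic_form_on M \<omega>"
    and "smooth_on M \<Phi>"
    and "\<forall>z\<in>M. rank (\<chi> \<alpha> i. pderiv_at i (\<lambda>y. \<Phi> y $ \<alpha>) z) = CARD('m)"
    and "\<forall>z\<in>M. det (\<chi> \<alpha> \<beta>. pderiv_at (Inl \<beta>) (\<lambda>y. \<Phi> y $ \<alpha>) z) \<noteq> 0"
    and "open V" and "smooth_on V f" and "N = graph_embedding f ` V"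
  shows "(nondegenerate_on V (restricted_form \<omega> f) \<and> closed_form_on V (restricted_form \<omega> f))
     \<longleftrightarrow> (\<forall>z\<in>N. det (\<chi> \<alpha> \<beta>. poisson_bracket \<omega> (\<lambda>y. \<Phi> y $ \<alpha>) (\<lambda>y. \<Phi> y $ \<beta>) z) \<noteq> 0)"
proof -
  have smooth\<omega>: "smooth_on M \<omega>" and skew: "\<And>z i j. z \<in> M \<Longrightarrow> \<omega> z $ i $ j = - \<omega> z $ j $ i"
    and nondeg: "\<And>z. z \<in> M \<Longrightarrow> det (\<omega> z) \<noteq> 0" and closed: "closed_form_on M \<omega>"
    using \<open>symplectic_form_on M \<omega>\<close> unfolding symplectic_form_on_def nondegenerate_on_def by blast+
  have e_M: "graph_embedding f x \<in> M" and e_\<Phi>: "\<Phi> (graph_embedding f x) = 0" if "x \<in> V" for x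
  proof -
    have "graph_embedding f x \<in> N" using \<open>N = graph_embedding f ` V\<close> that by blast
    then show "graph_embedding f x \<in> M" and "\<Phi> (graph_embedding f x) = 0"
      by (simp_all add: N_def vec_eq_iff)
  qed
  note e_Cr = Cr_on_graph_embedding[OF \<open>open V\<close> \<open>smooth_on V f\<close>]
  have closed_restricted: "closed_form_on V (restricted_form \<omega> f)"
    unfolding restricted_form_def[abs_def]
    by (rule closed_form_on_pullback[where M = M and e = "graph_embedding f" and \<omega> = \<omega>,
          OF \<open>open V\<close> e_Cr _ _ skew closed])
      (use e_M smooth_on_imp_differentiable[OF smooth\<omega>] in auto)
  \<comment> \<open>The equivalence holds point by point; since \<open>N\<close> is the image of
    \<open>V\<close>, it then passes to the quantified statements.\<close>
  have "det (restricted_form \<omega> f x) \<noteq> 0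
    \<longleftrightarrow> det (\<chi> \<alpha> \<beta>. poisson_bracket \<omega> (\<lambda>y. \<Phi> y $ \<alpha>) (\<lambda>y. \<Phi> y $ \<beta>) (graph_embedding f x)) \<noteq> 0"
    if "x \<in> V" for x
  proof -
    define z where "z = graph_embedding f x"
    have "z \<in> M" using e_M that by (simp add: z_def)
    define T :: "real ^ 'k ^ ('m + 'k)" where "T = (\<chi> i a. pderiv_at a (\<lambda>y. graph_embedding f y $ i) x)"
    define F :: "real ^ ('m + 'k) ^ 'm" where "F = (\<chi> \<alpha> i. pderiv_at i (\<lambda>y. \<Phi> y $ \<alpha>) z)"
    \<comment> \<open>By the chain rule this entry is a partial derivative of a component of
      \<open>\<Phi>\<close> along the graph, a function that is identically zero on the open set
      \<open>V\<close>.\<close>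
    have "(F ** T) $ \<alpha> $ a = 0" for \<alpha> a
    proof -
      have "(\<lambda>y. \<Phi> y $ \<alpha>) differentiable (at z)"
        using smooth_on_imp_differentiable[OF \<open>smooth_on M \<Phi>\<close> \<open>z \<in> M\<close>]
          bounded_linear.has_derivative[OF bounded_linear_vec_nth]
        unfolding differentiable_def by blast
      moreover have "(\<lambda>y. graph_embedding f y $ i) differentiable (at x)" for i
        using e_Cr[of "Suc 0" i] that by simp
      ultimately have "(F ** T) $ \<alpha> $ a = pderiv_at a (\<lambda>y. \<Phi> (graph_embedding f y) $ \<alpha>) x"
        using pderiv_at_compose[of "graph_embedding f" x "\<lambda>y. \<Phi> y $ \<alpha>"]
        by (simp add: F_def T_def z_def matrix_matrix_mult_def)
      also have "((\<lambda>y. \<Phi> (graph_embedding f y) $ \<alpha>) has_derivative (\<lambda>_. 0)) (at x)"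
        by (rule has_derivative_transform_within_open[OF has_derivative_const \<open>open V\<close> that])
          (simp add: e_\<Phi>)
      then have "pderiv_at a (\<lambda>y. \<Phi> (graph_embedding f y) $ \<alpha>) x = 0"
        by (rule pderiv_at_eqI)
      finally show ?thesis .
    qed
    then have FT: "F ** T = 0" by (simp add: vec_eq_iff)
    have B: "det (\<chi> \<alpha> \<beta>. F $ \<alpha> $ Inl \<beta>) \<noteq> 0"
      using assms(8) \<open>z \<in> M\<close> by (simp add: F_def)
    have TR: "T $ Inr a $ b = (if a = b then 1 else 0)" for a b
      by (simp add: T_def pderiv_at_graph_embedding_Inr)
    note K = graph_tangent_kernels[OF FT B TR]
    have "det (transpose T ** \<omega> z ** T) \<noteq> 0 \<longleftrightarrow> det (F ** matrix_inv (\<omega> z) ** transpose F) \<noteq> 0"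
      by (rule det_restriction_nonzero_iff[OF nondeg[OF \<open>z \<in> M\<close>] K])
    then show ?thesis
      unfolding restricted_form_eq_matrix_product poisson_bracket_eq_matrix_product
        T_def F_def z_def .
  qed
  then have "nondegenerate_on V (restricted_form \<omega> f) \<longleftrightarrow>
    (\<forall>z\<in>N. det (\<chi> \<alpha> \<beta>. poisson_bracket \<omega> (\<lambda>y. \<Phi> y $ \<alpha>) (\<lambda>y. \<Phi> y $ \<beta>) z) \<noteq> 0)"
    using \<open>N = graph_embedding f ` V\<close> by (simp add: nondegenerate_on_def)
  with closed_restricted show ?thesis by simp
qed

end
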